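(* Let $\mathbf{B}\in\mathbb{R}^{n\times n}$ and $\mathbf{R}\in\mathbb{R}^{d\times d}$ be symmetric positive definite matrices, let $\mathbf{x}_b\in\mathbb{R}^n$, $\mathbf{y}\in\mathbb{R}^d$, and let $h:\mathbb{R}^n\to\mathbb{R}^d$ be a map. Let $$J(\mathbf{x})=\tfrac12(\mathbf{x}-\mathbf{x}_b)^T\mathbf{B}^{-1}(\mathbf{x}-\mathbf{x}_b)+\tfrac12(\mathbf{y}-h[\mathbf{x}])^T\mathbf{R}^{-1}(\mathbf{y}-h[\mathbf{x}]),\qquad \mathbf{x}\in\mathbb{R}^n.$$ Let $1<\kappa_{max}<\kappa(\mathbf{R})$, let $\mathbf{R}_{RR}=\mathbf{R}+\delta\mathbf{I}_d$ with $\delta=\dfrac{\lambda_1-\lambda_d\kappa_{max}}{\kappa_{max}-1}$, and let $J_{RR}$ be the function obtained from $J$ by replacing $\mathbf{R}$ with $\mathbf{R}_{RR}$. Then for all $\mathbf{x}\in\mathbb{R}^n$, $$J_{RR}(\mathbf{x})=J(\mathbf{x})-\tfrac12(\mathbf{y}-h[\mathbf{x}])^T\mathbf{V}_{\mathbf{R}}\boldsymbol{\Lambda}_{\delta}\mathbf{V}_{\mathbf{R}}^T(\mathbf{y}-h[\mathbf{x}]),$$ where $\boldsymbol{\Lambda}_{\delta}$ is the diagonal matrix with entries $(\boldsymbol{\Lambda}_{\delta})_{ii}=\dfrac{\delta}{\lambda_i(\lambda_i+\delta)}$.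
   Context: $\lambda_1\ge\dots\ge\lambda_d>0$ are the eigenvalues of $\mathbf{R}$, and $\mathbf{R}=\mathbf{V}_{\mathbf{R}}\boldsymbol{\Lambda}\mathbf{V}_{\mathbf{R}}^T$ is an eigendecomposition with $\boldsymbol{\Lambda}=\operatorname{Diag}(\lambda_1,\dots,\lambda_d)$ and $\mathbf{V}_{\mathbf{R}}\in\mathbb{R}^{d\times d}$ a corresponding matrix of orthonormal eigenvectors. $\kappa(\mathbf{R})=\lambda_1/\lambda_d$ is the condition number. $J$ is the 3D-Var data assimilation objective function, with background $\mathbf{x}_b$, observations $\mathbf{y}$, observation operator $h$, background error covariance $\mathbf{B}$ and observation error covariance $\mathbf{R}$; passing from $\mathbf{R}$ to $\mathbf{R}_{RR}$ is the ridge regression reconditioning method with target condition number $\kappa_{max}$. $\mathbf{I}_d$ is the $d\times d$ identity matrix. *)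

theory Defs
  imports "HOL-Analysis.Analysis"
begin

definition sym_pos_def :: "real^'n^'n \<Rightarrow> bool" where
  "sym_pos_def A \<longleftrightarrow> transpose A = A \<and> (\<forall>v. v \<noteq> 0 \<longrightarrow> 0 < v \<bullet> (A *v v))"

definition diag_matrix :: "('n \<Rightarrow> real) \<Rightarrow> real^'n^'n" where
  "diag_matrix f = (\<chi> i j. if i = j then f i else 0)"

definition eigenvalues :: "real^'n^'n \<Rightarrow> real set" where
  "eigenvalues A = {l. \<exists>v. v \<noteq> 0 \<and> A *v v = l *\<^sub>R v}"

text \<open>The index type is linearly ordered, so that the eigenvalues can be listed (with
  multiplicity) in non-increasing order; \<open>Min UNIV\<close> and \<open>Max UNIV\<close> play the roles of the
  indices \<open>1\<close> and \<open>d\<close>.\<close>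

definition eigendecomposition ::
    "real^('d::{finite,linorder})^('d::{finite,linorder}) \<Rightarrow>
     real^('d::{finite,linorder})^('d::{finite,linorder}) \<Rightarrow> ('d::{finite,linorder} \<Rightarrow> real) \<Rightarrow> bool" where
  "eigendecomposition A V lam \<longleftrightarrow>
     antimono lam \<and> orthogonal_matrix V \<and> A = V ** diag_matrix lam ** transpose V"

text \<open>Only meaningful for symmetric positive definite matrices, whose eigenvalues form a
  finite nonempty set of positive reals: the ratio of the largest to the smallest one.\<close>

definition condition_number :: "real^'n^'n \<Rightarrow> real" where
  "condition_number A = Max (eigenvalues A) / Min (eigenvalues A)"

definition threeDVar ::
    "real^'n^'n \<Rightarrow> real^'d^'d \<Rightarrow> real^'n \<Rightarrow> real^'d \<Rightarrow> (real^'n \<Rightarrow> real^'d) \<Rightarrow> real^'n \<Rightarrow> real" where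
  "threeDVar B R xb y h x =
     1/2 * ((x - xb) \<bullet> (matrix_inv B *v (x - xb))) +
     1/2 * ((y - h x) \<bullet> (matrix_inv R *v (y - h x)))"

definition ridge_delta :: "('d::{finite,linorder} \<Rightarrow> real) \<Rightarrow> real \<Rightarrow> real" where
  "ridge_delta lam kmax = (lam (Min UNIV) - lam (Max UNIV) * kmax) / (kmax - 1)"

end

theory Submission
  imports Defs
begin

text \<open>
  For a fixed orthogonal \<open>V\<close>, the map sending \<open>f\<close> to \<open>V Diag(f) V\<^sup>T\<close> is a functional
  calculus: it carries pointwise sums, products and constants of functions on the index set to
  sums, products and scalar multiples of the identity, and hence pointwise reciprocals to
  inverses. Writing \<open>\<lambda>\<close> for the eigenvalues of \<open>R\<close>, both \<open>R\<close> and \<open>R + \<delta> I\<close> lie in its image,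
  as the values at \<open>\<lambda>\<close> and \<open>\<lambda> + \<delta>\<close>, so the difference of their inverses is its value at
  \<open>1/\<lambda> - 1/(\<lambda> + \<delta>) = \<delta>/(\<lambda>(\<lambda> + \<delta>))\<close>. The background term of the objective function does not
  involve \<open>R\<close> and cancels.

  Both reciprocals must make sense. The \<open>\<lambda>\<^sub>i\<close> are positive since \<open>R\<close> is positive definite, and
  \<open>\<lambda>\<^sub>i + \<delta>\<close> is positive because \<open>\<delta>\<close> is: the \<open>\<lambda>\<^sub>i\<close> are exactly the eigenvalues of \<open>R\<close>, so the
  condition number is the quotient of the first and the last of them, and the target condition
  number lies strictly below it.
\<close>

definition spectral_matrix :: "real^'n^'n \<Rightarrow> ('n \<Rightarrow> real) \<Rightarrow> real^'n^'n" where
  "spectral_matrix V f = V ** diag_matrix f ** transpose V"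

lemma diag_matrix_mult_vec_nth: "(diag_matrix f *v w) $ i = f i * w $ i"
  by (simp add: diag_matrix_def matrix_vector_mult_def mult_delta_left)

lemma diag_matrix_mult_vec_axis:
  "diag_matrix f *v axis i c = f i *\<^sub>R axis i c"
  by (auto simp: vec_eq_iff diag_matrix_mult_vec_nth axis_def)

lemma diag_matrix_mult_vec_diag_matrix_mult_vec:
  "diag_matrix f *v (diag_matrix g *v w) = diag_matrix (\<lambda>i. f i * g i) *v w"
  by (simp add: vec_eq_iff diag_matrix_mult_vec_nth)

lemma spectral_matrix_mult_vec:
  "spectral_matrix V f *v v = V *v (diag_matrix f *v (v v* V))"
  by (simp add: spectral_matrix_def flip: matrix_vector_mul_assoc)

lemma orthogonal_matrix_cancel_vec:
  fixes V :: "real^'n^'n"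
  assumes "orthogonal_matrix V"
  shows "(V *v v) v* V = v" and "V *v (v v* V) = v"
proof -
  have "(V *v v) v* V = (transpose V ** V) *v v" and "V *v (v v* V) = (V ** transpose V) *v v"
    by (simp_all flip: matrix_vector_mul_assoc)
  then show "(V *v v) v* V = v" and "V *v (v v* V) = v"
    using assms by (simp_all add: orthogonal_matrix_def)
qed

lemma spectral_matrix_mult:
  assumes "orthogonal_matrix V"
  shows "spectral_matrix V f ** spectral_matrix V g = spectral_matrix V (\<lambda>i. f i * g i)"
  unfolding matrix_eq
  by (simp add: spectral_matrix_mult_vec orthogonal_matrix_cancel_vec[OF assms]
        diag_matrix_mult_vec_diag_matrix_mult_vec flip: matrix_vector_mul_assoc)

lemma spectral_matrix_add:
  "spectral_matrix V (\<lambda>i. f i + g i) = spectral_matrix V f + spectral_matrix V g"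
proof -
  have "diag_matrix (\<lambda>i. f i + g i) = diag_matrix f + diag_matrix g"
    by (simp add: vec_eq_iff diag_matrix_def)
  then show ?thesis
    unfolding matrix_eq
    by (simp add: spectral_matrix_mult_vec matrix_vector_mult_add_rdistrib matrix_vector_right_distrib)
qed

lemma spectral_matrix_const:
  fixes V :: "real^'n^'n"
  assumes "orthogonal_matrix V"
  shows "spectral_matrix V (\<lambda>_. c) = c *\<^sub>R mat 1"
proof -
  have "diag_matrix (\<lambda>_. c) *v w = c *\<^sub>R w" for w :: "real^'n"
    by (simp add: vec_eq_iff diag_matrix_mult_vec_nth)
  then show ?thesis
    unfolding matrix_eq
    by (simp add: spectral_matrix_mult_vec matrix_vector_mult_scaleR
          orthogonal_matrix_cancel_vec[OF assms] flip: scaleR_matrix_vector_assoc)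
qed

lemma matrix_inv_eqI:
  assumes "A ** C = mat 1" and "C ** A = mat 1"
  shows "matrix_inv A = C"
proof -
  have "A ** matrix_inv A = mat 1"
    unfolding matrix_inv_def using someI[of "\<lambda>A'. A ** A' = mat 1 \<and> A' ** A = mat 1" C] assms
    by blast
  then have "C ** A ** matrix_inv A = C"
    by (simp flip: matrix_mul_assoc)
  then show ?thesis
    using assms(2) by simp
qed

lemma matrix_inv_spectral_matrix:
  assumes V: "orthogonal_matrix V" and f: "\<And>i. f i \<noteq> 0"
  shows "matrix_inv (spectral_matrix V f) = spectral_matrix V (\<lambda>i. 1 / f i)"
  using f
  by (intro matrix_inv_eqI)
    (simp_all add: spectral_matrix_mult[OF V] spectral_matrix_const[OF V])

text \<open>
  In the coordinates \<open>V\<^sup>T v\<close> the eigenvalue equation decouples into the scalar equations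
  \<open>f i * w $ i = l * w $ i\<close>, and a nonzero \<open>w\<close> has a coordinate that can be cancelled.
\<close>

lemma eigenvalues_spectral_matrix:
  assumes V: "orthogonal_matrix V"
  shows "eigenvalues (spectral_matrix V f) = range f"
proof (intro equalityI subsetI)
  fix l assume "l \<in> eigenvalues (spectral_matrix V f)"
  then obtain v where v: "v \<noteq> 0" "spectral_matrix V f *v v = l *\<^sub>R v"
    by (auto simp: eigenvalues_def)
  define w where "w = v v* V"
  have "w \<noteq> 0"
    using v(1) orthogonal_matrix_cancel_vec(2)[OF V, of v] by (auto simp: w_def)
  then obtain i where i: "w $ i \<noteq> 0"
    by (auto simp: vec_eq_iff)
  have "(spectral_matrix V f *v v) v* V = diag_matrix f *v w"
    by (simp add: spectral_matrix_mult_vec orthogonal_matrix_cancel_vec[OF V] w_def)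
  then have "diag_matrix f *v w = l *\<^sub>R w"
    by (simp add: v(2) w_def scaleR_vector_matrix_assoc)
  then have "f i * w $ i = l * w $ i"
    by (metis diag_matrix_mult_vec_nth vector_scaleR_component real_scaleR_def)
  with i show "l \<in> range f"
    by auto
next
  fix l assume "l \<in> range f"
  then obtain i where l: "l = f i" by blast
  define v where "v = V *v axis i 1"
  have "v \<noteq> 0"
    using orthogonal_matrix_cancel_vec(1)[OF V, of "axis i 1"]
    by (auto simp: v_def axis_eq_0_iff)
  moreover have "spectral_matrix V f *v v = l *\<^sub>R v"
    by (simp add: l v_def spectral_matrix_mult_vec orthogonal_matrix_cancel_vec[OF V]
          diag_matrix_mult_vec_axis matrix_vector_mult_scaleR)
  ultimately show "l \<in> eigenvalues (spectral_matrix V f)"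
    by (auto simp: eigenvalues_def)
qed

lemma sym_pos_def_eigenvalue_pos:
  assumes "sym_pos_def A" and "l \<in> eigenvalues A"
  shows "0 < l"
proof -
  obtain v where v: "v \<noteq> 0" "A *v v = l *\<^sub>R v"
    using assms(2) by (auto simp: eigenvalues_def)
  then have "0 < l * (v \<bullet> v)"
    using assms(1) by (auto simp: sym_pos_def_def)
  then show ?thesis
    by (rule zero_less_mult_pos2) (simp add: v(1))
qed

lemma condition_number_eigendecomposition:
  assumes "eigendecomposition A V lam"
  shows "condition_number A = lam (Min UNIV) / lam (Max UNIV)"
proof -
  from assms have anti: "antimono lam" and "eigenvalues A = range lam"
    using eigenvalues_spectral_matrix
    by (auto simp: eigendecomposition_def spectral_matrix_def)
  moreover have "Max (range lam) = lam (Min UNIV)"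
    by (rule Max_eqI) (auto intro: antimonoD[OF anti])
  moreover have "Min (range lam) = lam (Max UNIV)"
    by (rule Min_eqI) (auto intro: antimonoD[OF anti])
  ultimately show ?thesis
    by (simp add: condition_number_def)
qed

theorem theorem6:
  fixes B :: "real^'n^'n" and R R_RR V :: "real^('d::{finite,linorder})^('d::{finite,linorder})"
    and lam :: "'d \<Rightarrow> real" and xb :: "real^'n" and y :: "real^('d::{finite,linorder})"
    and h :: "real^'n \<Rightarrow> real^('d::{finite,linorder})" and kmax \<delta> :: real
  assumes "sym_pos_def B" and "sym_pos_def R"
    and "eigendecomposition R V lam"
    and "1 < kmax" and "kmax < condition_number R"
    and "\<delta> = ridge_delta lam kmax"
    and "R_RR = R + \<delta> *\<^sub>R mat 1"
  shows "\<forall>x. threeDVar B R_RR xb y h x =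
    threeDVar B R xb y h x -
    1/2 * ((y - h x) \<bullet>
      ((V ** diag_matrix (\<lambda>i. \<delta> / (lam i * (lam i + \<delta>))) ** transpose V) *v (y - h x)))"
proof -
  have V: "orthogonal_matrix V" and R: "R = spectral_matrix V lam"
    using assms(3) by (auto simp: eigendecomposition_def spectral_matrix_def)
  have lam_pos: "0 < lam i" for i
    using sym_pos_def_eigenvalue_pos[OF assms(2)] eigenvalues_spectral_matrix[OF V] R by blast
  have "kmax < lam (Min UNIV) / lam (Max UNIV)"
    using assms(5) condition_number_eigendecomposition[OF assms(3)] by simp
  then have \<delta>_pos: "0 < \<delta>"
    using assms(4) lam_pos by (simp add: assms(6) ridge_delta_def field_simps)
  have sum_pos: "0 < lam i + \<delta>" for i
    using lam_pos[of i] \<delta>_pos by simp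
  let ?correction = "spectral_matrix V (\<lambda>i. \<delta> / (lam i * (lam i + \<delta>)))"
  have R_RR: "R_RR = spectral_matrix V (\<lambda>i. lam i + \<delta>)"
    by (simp add: assms(7) R spectral_matrix_add spectral_matrix_const[OF V])
  have "1 / lam i = 1 / (lam i + \<delta>) + \<delta> / (lam i * (lam i + \<delta>))" for i
    using lam_pos[of i] sum_pos[of i] by (simp add: divide_simps)
  then have "spectral_matrix V (\<lambda>i. 1 / lam i) =
      spectral_matrix V (\<lambda>i. 1 / (lam i + \<delta>)) + ?correction"
    by (simp flip: spectral_matrix_add)
  moreover have "lam i \<noteq> 0" "lam i + \<delta> \<noteq> 0" for i
    using lam_pos[of i] sum_pos[of i] by simp_all
  ultimately have inverse: "matrix_inv R = matrix_inv R_RR + ?correction"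
    by (simp add: R R_RR matrix_inv_spectral_matrix[OF V])
  show ?thesis
    by (simp add: threeDVar_def inverse matrix_vector_mult_add_rdistrib inner_add_right
          spectral_matrix_def add_divide_distrib)
qed

end
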